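(* In the weighted graph setting described in the context, assume that the graph $\mathcal G^+$ with node set $B\cup\Omega^+\cup\partial\Omega$ and with edges those edges $e$ of $\mathcal G$ between these nodes for which $\sigma^+(e)>0$ is connected. Then the matrix $D'-\frac I2$ is invertible, where $I$ is the $|\partial\Omega|\times|\partial\Omega|$ identity matrix.
   Context: Graph. $\mathcal G=(\mathcal V,\mathcal E)$ is a finite connected undirected graph without self-edges. $\mathcal V$ is partitioned into four nonempty disjoint sets $B,\Omega^+,\partial\Omega,\Omega^-$ such that, among pairs of distinct sets of the partition, the only ones joined by at least one edge are $\{B,\Omega^+\}$, $\{\Omega^+,\partial\Omega\}$, $\{\partial\Omega,\Omega^-\}$ (so there are no edges between $B$ and $\partial\Omega$, $B$ and $\Omega^-$, or $\Omega^+$ and $\Omega^-$). Put $\mathcal V^\circ=\mathcal V\setminus B$. Laplacian. The discrete gradient $\nabla$ is the $|\mathcal E|\times|\mathcal V|$ matrix with $(\nabla u)_k=u_i-u_j$, where $i,j$ are the endpoints of edge $k$ in a fixed order. For $s\in[0,\infty)^{|\mathcal E|}$, $L(s)=\nabla^T\mathrm{diag}(s)\nabla$. A conductivity $\sigma\in(0,\infty)^{|\mathcal E|}$ is fixed. $L[X,Y]$ denotes the submatrix with rows $X$, columns $Y$; $R_X$ is the $|X|\times|\mathcal V|$ matrix with $R_Xu=u|_X$. Green function. $G=R_{\mathcal V^\circ}^T\,L(\sigma)[\mathcal V^\circ,\mathcal V^\circ]^{-1}R_{\mathcal V^\circ}$ (the inverse exists since $\mathcal G$ is connected). Edge partition of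 unity. Let $\mathcal E^+$ be the edges with at least one node in $B\cup\Omega^+$ and $\mathcal E^-$ the edges with at least one node in $\Omega^-$. Fix any $p^+,p^-\in[0,1]^{|\mathcal E|}$ with $p^++p^-=1$, $p^+|_{\mathcal E^+}=1$, $p^-|_{\mathcal E^-}=1$. Set $\sigma^\pm=p^\pm\sigma$ (componentwise), so $L(\sigma)=L(\sigma^+)+L(\sigma^-)$. Operators. $\gamma_0=R_{\partial\Omega}$, $\gamma_1^\pm=\mp R_{\partial\Omega}L(\sigma^\pm)$, $\mathcal S=G\gamma_0^T$. The Neumann-Poincaré (adjoint double layer) operator is the $|\partial\Omega|\times|\partial\Omega|$ matrix $D'=\frac12(\gamma_1^++\gamma_1^-)\mathcal S$. *)

theory Defs
  imports "HOL-Analysis.Analysis"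
begin

text \<open>
  A finite undirected graph on the vertex type \<open>'v\<close> is given by the endpoints \<open>src k\<close>, \<open>tgt k\<close> of
  its edges \<open>k :: 'e\<close>; which endpoint comes first is the fixed order used by the gradient and has no
  other meaning.  The injectivity condition says that the edges form a set of unordered pairs.
\<close>

definition simple_graph :: "('e \<Rightarrow> 'v) \<Rightarrow> ('e \<Rightarrow> 'v) \<Rightarrow> bool" where
  "simple_graph src tgt \<longleftrightarrow> (\<forall>k. src k \<noteq> tgt k) \<and> inj (\<lambda>k. {src k, tgt k})"

definition joined :: "('e \<Rightarrow> 'v) \<Rightarrow> ('e \<Rightarrow> 'v) \<Rightarrow> 'v set \<Rightarrow> 'v set \<Rightarrow> bool" where
  "joined src tgt X Y \<longleftrightarrow> (\<exists>k. \<exists>x\<in>X. \<exists>y\<in>Y. {src k, tgt k} = {x, y})"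

text \<open>Connectedness of the graph with node set \<open>X\<close> and edge set \<open>K\<close>, where the edges in \<open>K\<close>
  are supposed to have both endpoints in \<open>X\<close>.\<close>

definition graph_connected :: "('e \<Rightarrow> 'v) \<Rightarrow> ('e \<Rightarrow> 'v) \<Rightarrow> 'v set \<Rightarrow> 'e set \<Rightarrow> bool" where
  "graph_connected src tgt X K \<longleftrightarrow>
     (\<forall>u\<in>X. \<forall>v\<in>X. (u, v) \<in> {(x, y). \<exists>k\<in>K. {src k, tgt k} = {x, y}}\<^sup>*)"

definition node_partition ::
  "('e \<Rightarrow> 'v) \<Rightarrow> ('e \<Rightarrow> 'v) \<Rightarrow> 'v set \<Rightarrow> 'v set \<Rightarrow> 'v set \<Rightarrow> 'v set \<Rightarrow> bool" where
  "node_partition src tgt B \<Omega>p d\<Omega> \<Omega>m \<longleftrightarrow>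
     B \<noteq> {} \<and> \<Omega>p \<noteq> {} \<and> d\<Omega> \<noteq> {} \<and> \<Omega>m \<noteq> {} \<and>
     B \<inter> \<Omega>p = {} \<and> B \<inter> d\<Omega> = {} \<and> B \<inter> \<Omega>m = {} \<and>
     \<Omega>p \<inter> d\<Omega> = {} \<and> \<Omega>p \<inter> \<Omega>m = {} \<and> d\<Omega> \<inter> \<Omega>m = {} \<and>
     B \<union> \<Omega>p \<union> d\<Omega> \<union> \<Omega>m = UNIV \<and>
     joined src tgt B \<Omega>p \<and> joined src tgt \<Omega>p d\<Omega> \<and> joined src tgt d\<Omega> \<Omega>m \<and>
     \<not> joined src tgt B d\<Omega> \<and> \<not> joined src tgt B \<Omega>m \<and> \<not> joined src tgt \<Omega>p \<Omega>m"

definition gradient :: "('e::finite \<Rightarrow> 'v::finite) \<Rightarrow> ('e \<Rightarrow> 'v) \<Rightarrow> real^'v^'e" where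
  "gradient src tgt = matrix (\<lambda>u :: real^'v. \<chi> k. u $ src k - u $ tgt k)"

definition diag :: "real^'n \<Rightarrow> real^'n^'n" where
  "diag s = (\<chi> i j. if i = j then s $ i else 0)"

definition laplacian ::
  "('e::finite \<Rightarrow> 'v::finite) \<Rightarrow> ('e \<Rightarrow> 'v) \<Rightarrow> real^'e \<Rightarrow> real^'v^'v" where
  "laplacian src tgt s = transpose (gradient src tgt) ** diag s ** gradient src tgt"

text \<open>
  Rows and columns indexed by a vertex set \<open>X\<close> are indexed by a finite type \<open>'x\<close> together with an
  enumeration \<open>r :: 'x \<Rightarrow> 'v\<close> of \<open>X\<close>, that is, \<open>bij_betw r UNIV X\<close>.
\<close>

definition restr :: "('x::finite \<Rightarrow> 'v::finite) \<Rightarrow> real^'v^'x" where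
  "restr r = matrix (\<lambda>u :: real^'v. \<chi> i. u $ r i)"

definition submat :: "real^'v^'v \<Rightarrow> ('x \<Rightarrow> 'v) \<Rightarrow> ('y \<Rightarrow> 'v) \<Rightarrow> real^'y^'x" where
  "submat A r c = (\<chi> i j. A $ r i $ c j)"

text \<open>Below, \<open>rV\<close> enumerates the complement of \<open>B\<close> and \<open>rD\<close> enumerates \<open>\<partial>\<Omega>\<close>.\<close>

definition green ::
  "('e::finite \<Rightarrow> 'v::finite) \<Rightarrow> ('e \<Rightarrow> 'v) \<Rightarrow> ('i::finite \<Rightarrow> 'v) \<Rightarrow> real^'e \<Rightarrow> real^'v^'v" where
  "green src tgt rV \<sigma> =
     transpose (restr rV) ** matrix_inv (submat (laplacian src tgt \<sigma>) rV rV) ** restr rV"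

definition edge_partition_of_unity ::
  "('e::finite \<Rightarrow> 'v) \<Rightarrow> ('e \<Rightarrow> 'v) \<Rightarrow> 'v set \<Rightarrow> 'v set \<Rightarrow> 'v set \<Rightarrow> real^'e \<Rightarrow> real^'e \<Rightarrow> bool" where
  "edge_partition_of_unity src tgt B \<Omega>p \<Omega>m pp pm \<longleftrightarrow>
     (\<forall>k. pp $ k \<in> {0..1} \<and> pm $ k \<in> {0..1} \<and> pp $ k + pm $ k = 1) \<and>
     (\<forall>k. {src k, tgt k} \<inter> (B \<union> \<Omega>p) \<noteq> {} \<longrightarrow> pp $ k = 1) \<and>
     (\<forall>k. {src k, tgt k} \<inter> \<Omega>m \<noteq> {} \<longrightarrow> pm $ k = 1)"

definition cmul :: "real^'e \<Rightarrow> real^'e \<Rightarrow> real^'e" where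
  "cmul p s = (\<chi> k. p $ k * s $ k)"

definition single_layer ::
  "('e::finite \<Rightarrow> 'v::finite) \<Rightarrow> ('e \<Rightarrow> 'v) \<Rightarrow> ('i::finite \<Rightarrow> 'v) \<Rightarrow> ('d::finite \<Rightarrow> 'v)
    \<Rightarrow> real^'e \<Rightarrow> real^'d^'v" where
  "single_layer src tgt rV rD \<sigma> = green src tgt rV \<sigma> ** transpose (restr rD)"

definition gamma1_plus ::
  "('e::finite \<Rightarrow> 'v::finite) \<Rightarrow> ('e \<Rightarrow> 'v) \<Rightarrow> ('d::finite \<Rightarrow> 'v)
    \<Rightarrow> real^'e \<Rightarrow> real^'e \<Rightarrow> real^'v^'d" where
  "gamma1_plus src tgt rD \<sigma> pp = - (restr rD ** laplacian src tgt (cmul pp \<sigma>))"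

definition gamma1_minus ::
  "('e::finite \<Rightarrow> 'v::finite) \<Rightarrow> ('e \<Rightarrow> 'v) \<Rightarrow> ('d::finite \<Rightarrow> 'v)
    \<Rightarrow> real^'e \<Rightarrow> real^'e \<Rightarrow> real^'v^'d" where
  "gamma1_minus src tgt rD \<sigma> pm = restr rD ** laplacian src tgt (cmul pm \<sigma>)"

definition neumann_poincare ::
  "('e::finite \<Rightarrow> 'v::finite) \<Rightarrow> ('e \<Rightarrow> 'v) \<Rightarrow> ('i::finite \<Rightarrow> 'v) \<Rightarrow> ('d::finite \<Rightarrow> 'v)
    \<Rightarrow> real^'e \<Rightarrow> real^'e \<Rightarrow> real^'e \<Rightarrow> real^'d^'d" where
  "neumann_poincare src tgt rV rD \<sigma> pp pm =
     (1/2) *\<^sub>R ((gamma1_plus src tgt rD \<sigma> pp + gamma1_minus src tgt rD \<sigma> pm)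
                ** single_layer src tgt rV rD \<sigma>)"

end

theory Submission
  imports Defs
begin

text \<open>
  For a density \<open>g\<close> on \<open>\<partial>\<Omega>\<close> let \<open>u = S g\<close>.  Then \<open>u\<close> vanishes on \<open>B\<close>, is \<open>\<sigma>\<close>-harmonic on
  \<open>\<Omega>\<^sup>+ \<union> \<Omega>\<^sup>-\<close>, and satisfies \<open>L(\<sigma>) u = g\<close> on \<open>\<partial>\<Omega>\<close>.  The last equation is the jump
  relation \<open>(\<gamma>\<^sub>1\<^sup>- - \<gamma>\<^sub>1\<^sup>+) u = g\<close>, so \<open>(D' - I/2) g = \<gamma>\<^sub>1\<^sup>+ u\<close>.  If this vanishes, then
  the energy \<open>u \<bullet> L(\<sigma>\<^sup>+) u\<close> is zero, hence \<open>u = 0\<close> on the connected graph \<open>\<G>\<^sup>+\<close>.  In particular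
  \<open>u = 0\<close> on \<open>\<partial>\<Omega>\<close>, so the full energy \<open>u \<bullet> L(\<sigma>) u\<close> is zero as well, \<open>u\<close> vanishes
  everywhere, and \<open>g = 0\<close>.
\<close>

declare transpose_matrix_vector [simp del]

lemma restr_mult [simp]:
  fixes u :: "real^'v::finite"
  shows "(restr r *v u) $ i = u $ r i"
proof -
  have "linear (\<lambda>u :: real^'v. \<chi> i. u $ r i)"
    by (rule linearI) (simp_all add: vec_eq_iff)
  from matrix_vector_mul(2)[OF this] show ?thesis
    by (simp add: restr_def fun_eq_iff)
qed

lemma gradient_mult [simp]:
  fixes u :: "real^'v::finite"
  shows "(gradient src tgt *v u) $ k = u $ src k - u $ tgt k"
proof -
  have "linear (\<lambda>u :: real^'v. \<chi> k. u $ src k - u $ tgt k)"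
    by (rule linearI) (simp_all add: vec_eq_iff algebra_simps)
  from matrix_vector_mul(2)[OF this] show ?thesis
    by (simp add: gradient_def fun_eq_iff)
qed

lemma diag_mult [simp]: "(diag s *v x) $ k = s $ k * x $ k"
  by (simp add: diag_def matrix_vector_mult_def if_distrib[where f = "\<lambda>a. a * _"] cong: if_cong)

lemma matrix_inv_right:
  assumes "invertible A"
  shows "A ** matrix_inv A = mat 1"
  using someI_ex[OF assms[unfolded invertible_def]] by (simp add: matrix_inv_def)

lemma restr_nth: "restr r $ i $ v = (if v = r i then 1 else 0)"
proof -
  have "restr r $ i $ v = (restr r *v axis v 1) $ i"
    by (simp add: matrix_vector_mult_basis column_def)
  then show ?thesis
    by (auto simp: axis_def)
qed

text \<open>The transpose of a restriction is extension by zero from \<open>range r\<close>;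
  injectivity of \<open>r\<close> leaves exactly one nonzero term in the sum.\<close>

lemma transpose_restr_mult:
  assumes "inj r"
  shows "(transpose (restr r) *v z) $ r i = z $ i"
  by (simp add: matrix_vector_mult_def transpose_def restr_nth inj_eq[OF assms]
      if_distrib[where f = "\<lambda>a. a * _"] cong: if_cong)

lemma transpose_restr_mult_outside:
  assumes "v \<notin> range r"
  shows "(transpose (restr r) *v z) $ v = 0"
  using assms by (auto simp: matrix_vector_mult_def transpose_def restr_nth intro!: sum.neutral)

lemma submat_eq: "submat A r c = restr r ** A ** transpose (restr c)"
  by (simp add: vec_eq_iff submat_def matrix_matrix_mult_def transpose_def restr_nth
      if_distrib[where f = "\<lambda>a. a * _"] if_distrib[where f = "\<lambda>a. _ * a"] cong: if_cong)

text \<open>Moving the transposed gradient onto \<open>w\<close> gives the weighted Dirichlet form.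
  With \<open>w = u\<close> it is a sum of squares, and with \<open>w = axis v 1\<close> it is the
  row of the Laplacian at \<open>v\<close>.\<close>

lemma inner_laplacian:
  "w \<bullet> (laplacian src tgt s *v u) =
     (\<Sum>k\<in>UNIV. s $ k * (w $ src k - w $ tgt k) * (u $ src k - u $ tgt k))"
proof -
  have "w \<bullet> (laplacian src tgt s *v u) =
      (gradient src tgt *v w) \<bullet> (diag s *v (gradient src tgt *v u))"
    by (simp add: laplacian_def transpose_matrix_vector inner_commute[of w] dot_lmul_matrix
        flip: matrix_vector_mul_assoc) (rule inner_commute)
  also have "\<dots> = (\<Sum>k\<in>UNIV. s $ k * (w $ src k - w $ tgt k) * (u $ src k - u $ tgt k))"
    by (simp add: inner_vec_def mult_ac)
  finally show ?thesis .
qed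

lemma laplacian_mult_nth:
  "(laplacian src tgt s *v u) $ v =
     (\<Sum>k\<in>UNIV. s $ k * ((if src k = v then 1 else 0) - (if tgt k = v then 1 else 0))
        * (u $ src k - u $ tgt k))"
proof -
  have "(laplacian src tgt s *v u) $ v = axis v 1 \<bullet> (laplacian src tgt s *v u)"
    by (simp add: inner_axis')
  then show ?thesis
    by (simp add: inner_laplacian axis_def)
qed

text \<open>Only edges incident to \<open>v\<close> enter the row at \<open>v\<close>. This lets the
  Laplacian of \<open>cmul pp \<sigma>\<close> be replaced by a simpler one, node by node.\<close>

lemma laplacian_cong_at:
  assumes "\<And>k. v \<in> {src k, tgt k} \<Longrightarrow> s $ k = s' $ k"
  shows "(laplacian src tgt s *v u) $ v = (laplacian src tgt s' *v u) $ v"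
  unfolding laplacian_mult_nth using assms by (intro sum.cong) auto

lemma laplacian_add_mult:
  "laplacian src tgt (s + s') *v u = laplacian src tgt s *v u + laplacian src tgt s' *v u"
  by (simp add: vec_eq_iff laplacian_mult_nth distrib_right sum.distrib)

text \<open>All terms of the energy are nonnegative, so each is zero, and \<open>u\<close> takes
  equal values at the ends of every edge in \<open>K\<close>. The zero at \<open>b\<close> then
  spreads along paths. Keeping \<open>X\<close> and \<open>K\<close> general covers both the whole
  graph and the subgraph of \<open>pp\<close>.\<close>

lemma zero_energy_imp_zero:
  assumes energy: "u \<bullet> (laplacian src tgt s *v u) = 0"
    and nonneg: "\<And>k. 0 \<le> s $ k"
    and conn: "graph_connected src tgt X K"
    and pos: "\<And>k. k \<in> K \<Longrightarrow> 0 < s $ k"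
    and b: "b \<in> X" "u $ b = 0"
    and v: "v \<in> X"
  shows "u $ v = 0"
proof -
  have "(\<Sum>k\<in>UNIV. s $ k * (u $ src k - u $ tgt k)\<^sup>2) = 0"
    using energy by (simp add: inner_laplacian power2_eq_square mult.assoc)
  then have "s $ k * (u $ src k - u $ tgt k)\<^sup>2 = 0" for k
    by (subst (asm) sum_nonneg_eq_0_iff) (auto simp: nonneg)
  then have edge: "u $ src k = u $ tgt k" if "k \<in> K" for k
    using pos[OF that] by (metis less_irrefl mult_eq_0_iff right_minus_eq zero_eq_power2)
  have "(b, v) \<in> {(x, y). \<exists>k\<in>K. {src k, tgt k} = {x, y}}\<^sup>*"
    using conn b v by (auto simp: graph_connected_def)
  then show ?thesis
  proof induction
    case base
    show ?case using b by simp
  next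
    case (step y z)
    then show ?case
      using edge by (auto simp: doubleton_eq_iff)
  qed
qed

lemma inner_eq_0:
  fixes u w :: "real^'n"
  assumes "\<And>v. u $ v = 0 \<or> w $ v = 0"
  shows "u \<bullet> w = 0"
  unfolding inner_vec_def using assms by (intro sum.neutral) auto

text \<open>Extend a kernel vector by zero to \<open>B\<close>. At each node the extension or its
  Laplacian vanishes, so the energy is zero and connectedness carries the zero on \<open>B\<close>
  to all nodes.\<close>

lemma invertible_submat_laplacian:
  assumes conn: "graph_connected src tgt UNIV UNIV"
    and rV: "bij_betw rV UNIV (UNIV - B)" and "B \<noteq> {}"
    and pos: "\<And>k. 0 < \<sigma> $ k"
  shows "invertible (submat (laplacian src tgt \<sigma>) rV rV)"
proof -
  have inj: "inj rV" and range: "range rV = UNIV - B"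
    using rV by (auto simp: bij_betw_def)
  obtain b where b: "b \<in> B"
    using \<open>B \<noteq> {}\<close> by blast
  have "z = 0" if z: "submat (laplacian src tgt \<sigma>) rV rV *v z = 0" for z
  proof -
    let ?u = "transpose (restr rV) *v z"
    have "restr rV *v (laplacian src tgt \<sigma> *v ?u) = 0"
      using z by (simp add: submat_eq matrix_vector_mul_assoc matrix_mul_assoc)
    then have "(laplacian src tgt \<sigma> *v ?u) $ rV i = 0" for i
      by (metis restr_mult zero_index)
    then have energy: "?u \<bullet> (laplacian src tgt \<sigma> *v ?u) = 0"
      using transpose_restr_mult_outside[of _ rV z] by (intro inner_eq_0) (metis rangeE)
    have "?u $ b = 0"
      using b range by (intro transpose_restr_mult_outside) auto
    then have "?u $ v = 0" for v
      using zero_energy_imp_zero[OF energy _ conn, of b v] by (auto simp: pos less_imp_le)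
    then show "z = 0"
      by (metis transpose_restr_mult[OF inj] vec_eq_iff zero_index)
  qed
  then show ?thesis
    unfolding invertible_left_inverse matrix_left_invertible_ker by blast
qed

lemma single_layer_zero_on_boundary:
  assumes "range rV = UNIV - B" "v \<in> B"
  shows "(single_layer src tgt rV rD \<sigma> *v g) $ v = 0"
  unfolding single_layer_def green_def
  by (simp add: transpose_restr_mult_outside assms flip: matrix_vector_mul_assoc)

text \<open>Off \<open>B\<close>, the Green function is a right inverse of the Laplacian, so the
  potential has as its source the density \<open>g\<close> extended by zero.\<close>

lemma laplacian_single_layer:
  assumes conn: "graph_connected src tgt UNIV UNIV"
    and rV: "bij_betw rV UNIV (UNIV - B)" and "B \<noteq> {}"
    and pos: "\<And>k. 0 < \<sigma> $ k" and "v \<notin> B"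
  shows "(laplacian src tgt \<sigma> *v (single_layer src tgt rV rD \<sigma> *v g)) $ v =
    (transpose (restr rD) *v g) $ v"
proof -
  let ?A = "submat (laplacian src tgt \<sigma>) rV rV"
  let ?f = "transpose (restr rD) *v g"
  obtain i where i: "v = rV i"
    using rV \<open>v \<notin> B\<close> by (auto simp: bij_betw_def)
  have "restr rV *v (laplacian src tgt \<sigma> *v (single_layer src tgt rV rD \<sigma> *v g)) =
      (?A ** matrix_inv ?A) *v (restr rV *v ?f)"
    by (simp add: single_layer_def green_def submat_eq matrix_vector_mul_assoc matrix_mul_assoc)
  also have "\<dots> = restr rV *v ?f"
    using invertible_submat_laplacian[OF conn rV \<open>B \<noteq> {}\<close> pos] by (simp add: matrix_inv_right)
  finally show ?thesis
    unfolding i by (metis restr_mult)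
qed

theorem lemma4p3:
  fixes src tgt :: "'e::finite \<Rightarrow> 'v::finite"
    and B \<Omega>p d\<Omega> \<Omega>m :: "'v set"
    and rV :: "'i::finite \<Rightarrow> 'v" and rD :: "'d::finite \<Rightarrow> 'v"
    and \<sigma> pp pm :: "real^'e"
  assumes "simple_graph src tgt"
    and "graph_connected src tgt UNIV UNIV"
    and "node_partition src tgt B \<Omega>p d\<Omega> \<Omega>m"
    and "bij_betw rV UNIV (UNIV - B)"
    and "bij_betw rD UNIV d\<Omega>"
    and "\<forall>k. \<sigma> $ k > 0"
    and "edge_partition_of_unity src tgt B \<Omega>p \<Omega>m pp pm"
    and "graph_connected src tgt (B \<union> \<Omega>p \<union> d\<Omega>)
           {k. {src k, tgt k} \<subseteq> B \<union> \<Omega>p \<union> d\<Omega> \<and> cmul pp \<sigma> $ k > 0}"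
  shows "invertible (neumann_poincare src tgt rV rD \<sigma> pp pm - (1/2) *\<^sub>R (mat 1 :: real^'d^'d))"
proof -
  have conn: "graph_connected src tgt UNIV UNIV" and rV: "bij_betw rV UNIV (UNIV - B)"
    and pos: "\<And>k. 0 < \<sigma> $ k"
    using assms by auto
  have part: "B \<noteq> {}" "B \<inter> d\<Omega> = {}" "B \<union> \<Omega>p \<union> d\<Omega> \<union> \<Omega>m = UNIV"
    using assms(3) by (auto simp: node_partition_def)
  have rD: "inj rD" "range rD = d\<Omega>"
    using assms(5) by (auto simp: bij_betw_def)
  have pu: "0 \<le> pp $ k" "pp $ k + pm $ k = 1"
    "{src k, tgt k} \<inter> (B \<union> \<Omega>p) \<noteq> {} \<Longrightarrow> pp $ k = 1"
    "{src k, tgt k} \<inter> \<Omega>m \<noteq> {} \<Longrightarrow> pm $ k = 1" for k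
    using assms(7) by (auto simp: edge_partition_of_unity_def)
  let ?L = "laplacian src tgt"
  let ?Lp = "?L (cmul pp \<sigma>)" and ?Lm = "?L (cmul pm \<sigma>)"
  let ?D = "neumann_poincare src tgt rV rD \<sigma> pp pm"
  have "cmul pp \<sigma> + cmul pm \<sigma> = \<sigma>"
    by (simp add: vec_eq_iff cmul_def pu(2) flip: distrib_right)
  then have L_split: "?L \<sigma> *v u = ?Lp *v u + ?Lm *v u" for u
    by (metis laplacian_add_mult)
  have "g = 0" if g: "(?D - (1/2) *\<^sub>R (mat 1 :: real^'d^'d)) *v g = 0" for g
  proof -
    define u where "u = single_layer src tgt rV rD \<sigma> *v g"
    obtain b where b: "b \<in> B"
      using part by blast
    have u_B: "u $ v = 0" if "v \<in> B" for v
      unfolding u_def using rV that by (intro single_layer_zero_on_boundary) (auto simp: bij_betw_def)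
    have Lu: "(?L \<sigma> *v u) $ v = (transpose (restr rD) *v g) $ v" if "v \<notin> B" for v
      unfolding u_def by (rule laplacian_single_layer[OF conn rV part(1) pos that])
    have harmonic: "(?L \<sigma> *v u) $ v = 0" if "v \<notin> B" "v \<notin> d\<Omega>" for v
      using Lu[OF that(1)] that(2) rD by (simp add: transpose_restr_mult_outside)
    have jump: "(?L \<sigma> *v u) $ rD i = g $ i" for i
      using Lu[of "rD i"] part rD by (force simp: transpose_restr_mult)
    have "2 *\<^sub>R (?D *v g) = - (restr rD *v (?Lp *v u)) + restr rD *v (?Lm *v u)"
      unfolding neumann_poincare_def gamma1_plus_def gamma1_minus_def u_def
      by (simp add: matrix_vector_mult_diff_rdistrib
          flip: scaleR_matrix_vector_assoc matrix_vector_mul_assoc)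
    \<comment> \<open>This is the kernel condition; the jump relation supplies a second expression
      for \<open>g\<close>, and subtracting the two isolates \<open>?Lp *v u\<close>.\<close>
    moreover have "2 *\<^sub>R (?D *v g) = g"
      using g by (simp add: matrix_vector_mult_diff_rdistrib scaleR_matrix_vector_assoc[symmetric])
    ultimately have "g $ i = - (?Lp *v u) $ rD i + (?Lm *v u) $ rD i" for i
      by (metis restr_mult vector_add_component vector_uminus_component)
    moreover have "g $ i = (?Lp *v u) $ rD i + (?Lm *v u) $ rD i" for i
      by (simp add: L_split flip: jump)
    ultimately have "(?Lp *v u) $ rD i = 0" for i
      by (smt (verit))
    then have Lp_d: "(?Lp *v u) $ v = 0" if "v \<in> d\<Omega>" for v
      using that rD by blast
    have Lp_p: "(?Lp *v u) $ v = 0" if "v \<in> \<Omega>p" "v \<notin> B" "v \<notin> d\<Omega>" for v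
    proof -
      have "(?Lp *v u) $ v = (?L \<sigma> *v u) $ v"
        using that(1) pu(3) by (intro laplacian_cong_at) (auto simp: cmul_def)
      then show ?thesis
        using harmonic that by simp
    qed
    have Lp_m: "(?Lp *v u) $ v = 0" if "v \<in> \<Omega>m" for v
    proof -
      \<comment> \<open>Edges touching \<open>\<Omega>m\<close> have \<open>pm $ k = 1\<close>,
        which leaves no weight for \<open>pp\<close>.\<close>
      have "pp $ k = 0" if "v \<in> {src k, tgt k}" for k
        using pu(2)[of k] pu(4)[of k] that \<open>v \<in> \<Omega>m\<close> by auto
      then have "(?Lp *v u) $ v = (?L 0 *v u) $ v"
        by (intro laplacian_cong_at) (auto simp: cmul_def)
      then show ?thesis
        by (simp add: laplacian_mult_nth)
    qed
    have "u $ v = 0 \<or> (?Lp *v u) $ v = 0" for v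
      using part(3) u_B[of v] Lp_d[of v] Lp_p[of v] Lp_m[of v] by blast
    then have "u \<bullet> (?Lp *v u) = 0"
      by (rule inner_eq_0)
    \<comment> \<open>Connectedness of the subgraph of \<open>pp\<close> enters here: the zero at
      \<open>b\<close> reaches \<open>d\<Omega>\<close>.\<close>
    then have u_d: "u $ v = 0" if "v \<in> d\<Omega>" for v
      by (rule zero_energy_imp_zero[OF _ _ assms(8), where b = b])
         (use that b u_B in \<open>auto simp: cmul_def pu(1) pos less_imp_le\<close>)
    \<comment> \<open>On \<open>d\<Omega>\<close> the Laplacian of \<open>u\<close> is
      \<open>g\<close>, not yet known to vanish, but there \<open>u\<close> itself does.\<close>
    have "u \<bullet> (?L \<sigma> *v u) = 0"
      using u_B u_d harmonic by (intro inner_eq_0) blast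
    then have "u $ v = 0" for v
      by (rule zero_energy_imp_zero[OF _ _ conn, where b = b])
         (use b u_B in \<open>auto simp: pos less_imp_le\<close>)
    then have "u = 0"
      by (simp add: vec_eq_iff)
    then show "g = 0"
      by (intro vec_eq_iff[THEN iffD2]) (simp flip: jump)
  qed
  then show ?thesis
    unfolding invertible_left_inverse matrix_left_invertible_ker by blast
qed

end
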